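(* Let $f(\mathbf{z}) = \det\big(A_0 + \sum_{j=1}^n A_j z_j\big)$ with Hermitian $d \times d$ matrices $A_0, \ldots, A_n$, and suppose that $f$ has degree $d$, that the initial form $\mathrm{in}(f)$ is irreducible, and that there exists $\mathbf{e} \in \mathbb{R}^n$ with $\sum_{j=1}^n A_j e_j \succ 0$. Let $K \subseteq \mathbb{R}^n$ be a proper cone and let $M(\mathbf{x}) = \sum_{j=1}^n M_j x_j$, with symmetric $l \times l$ matrices $M_1,\dots,M_n$, be a linear matrix pencil with $K = \{\mathbf{x} \in \mathbb{R}^n : M(\mathbf{x}) \succeq 0\}$. If there exists a Hermitian block matrix $C = (C_{ij})_{i,j=1}^l$ with blocks $C_{ij}$ of size $d \times d$ and $$C = (C_{ij})_{i,j=1}^l \succeq 0, \qquad \sigma A_p = \sum_{i,j=1}^l (M_p)_{ij} C_{ij} \quad \text{for all } p = 1, \ldots, n,$$ for some $\sigma \in \{-1,1\}$, then $f$ is $K$-stable. Deciding whether such a block matrix $C$ exists is a semidefinite feasibility problem.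
   Context: A proper cone in $\mathbb{R}^n$ is a full-dimensional, closed, pointed convex cone. A polynomial $f \in \mathbb{C}[z_1,\dots,z_n]$ is $K$-stable if $f(\mathbf{z}) \neq 0$ whenever $\mathbf{z} \in \mathbb{C}^n$ has componentwise imaginary part $(\mathrm{Im}(z_1),\dots,\mathrm{Im}(z_n))$ in the interior of $K$. The initial form of $f$ is $\mathrm{in}(f)(\mathbf{z}) = f_h(0,\mathbf{z})$, where $f_h$ is the homogenization of $f$ with respect to a new variable $z_0$ (so $\mathrm{in}(f)$ is the homogeneous part of $f$ of top degree). $X \succ 0$ and $X \succeq 0$ mean that the Hermitian matrix $X$ is positive definite, respectively positive semidefinite. $(M_p)_{ij}$ is the scalar $(i,j)$ entry of $M_p$. A semidefinite feasibility problem is the problem of deciding whether there is a positive semidefinite matrix whose entries satisfy a given finite system of linear equations. *)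

theory Defs
  imports
    "HOL-Analysis.Analysis"
    "HOL-Library.Poly_Mapping"
    "HOL-Computational_Algebra.Factorial_Ring"
begin

section \<open>Multivariate polynomials\<close>

text \<open>
  Polynomials with coefficients in \<^typ>\<open>'a\<close> and variables indexed by \<^typ>\<open>'n\<close>: a finitely
  supported map from exponent vectors to coefficients. Products are convolution products, so
  \<^const>\<open>irreducible\<close> and \<^const>\<open>det\<close> at this type refer to the polynomial ring.
\<close>

type_synonym ('n, 'a) mpoly = "('n \<Rightarrow>\<^sub>0 nat) \<Rightarrow>\<^sub>0 'a"

definition Const :: "'a::zero \<Rightarrow> ('n, 'a) mpoly" where
  "Const c = Poly_Mapping.single 0 c"

definition Var :: "'n \<Rightarrow> ('n, 'a::zero_neq_one) mpoly" where
  "Var i = Poly_Mapping.single (Poly_Mapping.single i 1) 1"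

definition monom_degree :: "('n::finite \<Rightarrow>\<^sub>0 nat) \<Rightarrow> nat" where
  "monom_degree m = (\<Sum>i\<in>UNIV. Poly_Mapping.lookup m i)"

text \<open>The zero polynomial gets total degree 0.\<close>

definition total_degree :: "('n::finite, 'a::zero) mpoly \<Rightarrow> nat" where
  "total_degree p = Max (insert 0 (monom_degree ` Poly_Mapping.keys p))"

text \<open>\<open>poly_eval h s p\<close> applies \<open>h\<close> to the coefficients of \<open>p\<close> and substitutes \<open>s i\<close> for the
  \<open>i\<close>-th variable.\<close>

definition poly_eval ::
    "('a::zero \<Rightarrow> 'b::comm_semiring_1) \<Rightarrow> ('n::finite \<Rightarrow> 'b) \<Rightarrow> ('n, 'a) mpoly \<Rightarrow> 'b" where
  "poly_eval h s p =
     (\<Sum>m\<in>Poly_Mapping.keys p. h (Poly_Mapping.lookup p m) * (\<Prod>i\<in>UNIV. s i ^ Poly_Mapping.lookup m i))"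

text \<open>The new variable of the homogenization is \<^const>\<open>None\<close>; the old variable \<open>i\<close> becomes
  \<open>Some i\<close>.\<close>

definition homogenization ::
    "('n::finite, 'a::comm_monoid_add) mpoly \<Rightarrow> ('n option, 'a) mpoly" where
  "homogenization p =
     (\<Sum>m\<in>Poly_Mapping.keys p.
        Poly_Mapping.single
          (Poly_Mapping.single None (total_degree p - monom_degree m)
            + (\<Sum>i\<in>UNIV. Poly_Mapping.single (Some i) (Poly_Mapping.lookup m i)))
          (Poly_Mapping.lookup p m))"

text \<open>\<open>f\<^sub>h(0, z)\<close>, i.e. the homogeneous part of \<open>f\<close> of top degree.\<close>

definition initial_form :: "('n::finite, 'a::comm_semiring_1) mpoly \<Rightarrow> ('n, 'a) mpoly" where
  "initial_form p = poly_eval Const (case_option 0 Var) (homogenization p)"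


section \<open>Hermitian matrices\<close>

definition hermitian :: "complex^'m^'m \<Rightarrow> bool" where
  "hermitian X \<longleftrightarrow> (\<forall>i j. X $ i $ j = cnj (X $ j $ i))"

definition quad_form :: "complex^'m^'m \<Rightarrow> complex^'m \<Rightarrow> complex" where
  "quad_form X v = (\<Sum>i\<in>UNIV. \<Sum>j\<in>UNIV. cnj (v $ i) * X $ i $ j * v $ j)"

text \<open>The quadratic form of a Hermitian matrix is real-valued, so taking real parts below loses
  nothing.\<close>

definition pos_semidef :: "complex^'m^'m \<Rightarrow> bool" where
  "pos_semidef X \<longleftrightarrow> hermitian X \<and> (\<forall>v. 0 \<le> Re (quad_form X v))"

definition pos_def :: "complex^'m^'m \<Rightarrow> bool" where
  "pos_def X \<longleftrightarrow> hermitian X \<and> (\<forall>v. v \<noteq> 0 \<longrightarrow> 0 < Re (quad_form X v))"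

text \<open>\<open>x\<^sub>1 A\<^sub>1 + \<dots> + x\<^sub>n A\<^sub>n\<close>, for real or complex matrices \<open>A\<^sub>j\<close>.\<close>

definition pencil :: "('n::finite \<Rightarrow> 'a::real_vector^'m^'m) \<Rightarrow> real^'n \<Rightarrow> 'a^'m^'m" where
  "pencil A x = (\<Sum>j\<in>UNIV. x $ j *\<^sub>R A j)"

text \<open>\<open>det (A\<^sub>0 + A\<^sub>1 z\<^sub>1 + \<dots> + A\<^sub>n z\<^sub>n)\<close>, as the determinant of a matrix with polynomial entries.\<close>

definition det_poly ::
    "complex^'d^'d \<Rightarrow> ('n::finite \<Rightarrow> complex^'d^'d) \<Rightarrow> ('n, complex) mpoly" where
  "det_poly A0 A =
     det (\<chi> a b. Const (A0 $ a $ b) + (\<Sum>j\<in>UNIV. Const (A j $ a $ b) * Var j))"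


section \<open>Cones and stability\<close>

definition proper_cone :: "(real^'n) set \<Rightarrow> bool" where
  "proper_cone K \<longleftrightarrow>
     convex_cone K \<and> closed K \<and> aff_dim K = int CARD('n) \<and> (\<forall>x\<in>K. - x \<in> K \<longrightarrow> x = 0)"

definition K_stable :: "(real^'n) set \<Rightarrow> ('n, complex) mpoly \<Rightarrow> bool" where
  "K_stable K f \<longleftrightarrow>
     (\<forall>z :: complex^'n. (\<chi> j. Im (z $ j)) \<in> interior K \<longrightarrow> poly_eval (\<lambda>c. c) (($) z) f \<noteq> 0)"


section \<open>Semidefinite feasibility problems\<close>

text \<open>
  A linear equation \<open>\<Sum>r,c. B\<^bsub>rc\<^esub> X\<^bsub>rc\<^esub> = \<beta>\<close> in the entries of \<open>X\<close> is given as the pair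
  \<open>(B, \<beta>)\<close>. The semidefinite feasibility problem with the finite system \<open>S\<close> asks whether
  \<open>sdp_feasible_set S\<close> is nonempty.
\<close>

definition sdp_feasible_set :: "((complex^'m^'m) \<times> complex) set \<Rightarrow> (complex^'m^'m) set" where
  "sdp_feasible_set S =
     {X. pos_semidef X \<and>
         (\<forall>(B, \<beta>)\<in>S. (\<Sum>r\<in>UNIV. \<Sum>c\<in>UNIV. B $ r $ c * X $ r $ c) = \<beta>)}"

text \<open>Row and column indices of a block matrix are pairs (block index, index inside the block).\<close>

definition block :: "'a^('l::finite \<times> 'd::finite)^('l \<times> 'd) \<Rightarrow> 'l \<Rightarrow> 'l \<Rightarrow> 'a^'d^'d" where
  "block C i j = (\<chi> a b. C $ (i, a) $ (j, b))"

definition certificate ::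
    "('n \<Rightarrow> complex^'d^'d) \<Rightarrow> ('n \<Rightarrow> real^'l^'l) \<Rightarrow> real
      \<Rightarrow> complex^('l \<times> 'd)^('l \<times> 'd) \<Rightarrow> bool" where
  "certificate A M \<sigma> C \<longleftrightarrow>
     pos_semidef C \<and>
     (\<forall>p. \<sigma> *\<^sub>R A p = (\<Sum>i\<in>UNIV. \<Sum>j\<in>UNIV. M p $ i $ j *\<^sub>R block C i j))"

text \<open>For each \<open>p\<close> and each position \<open>(a, b)\<close>, the \<open>(a, b)\<close> entry of
  \<open>\<Sum>i,j. (M\<^sub>p)\<^bsub>ij\<^esub> C\<^bsub>ij\<^esub> = \<sigma> A\<^sub>p\<close>.\<close>

definition certificate_system ::
    "('n::finite \<Rightarrow> complex^'d^'d) \<Rightarrow> ('n \<Rightarrow> real^'l^'l) \<Rightarrow> real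
      \<Rightarrow> ((complex^('l \<times> 'd)^('l \<times> 'd)) \<times> complex) set" where
  "certificate_system A M \<sigma> =
     (\<Union>p. \<Union>a. \<Union>b.
        {(\<chi> r c. if snd r = a \<and> snd c = b then of_real (M p $ fst r $ fst c) else 0,
          of_real \<sigma> * A p $ a $ b)})"

end

theory Submission
  imports Defs
begin

text \<open>
  Contracting the block matrix \<open>C \<succeq> 0\<close> with \<open>v\<close> in each block gives a semidefinite \<open>l \<times> l\<close> matrix
  \<open>D\<close> with \<open>\<sigma> v\<^sup>* A(x) v = tr (M(x) D)\<close>, where \<open>A(x) = \<Sum>\<^sub>j x\<^sub>j A\<^sub>j\<close>, so \<open>\<sigma> A(x) \<succeq> 0\<close> on \<open>K\<close>. For fixed
  \<open>v \<noteq> 0\<close> this is a linear functional of \<open>x\<close> that is nonnegative on \<open>K\<close> and nonzero at \<open>e\<close>, hence positive in the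
  interior of \<open>K\<close>. If \<open>z = x + i y\<close> with \<open>y\<close> interior and \<open>A\<^sub>0 + A(z)\<close> kills \<open>v\<close>, the imaginary part
  of \<open>v\<^sup>* (A\<^sub>0 + A(z)) v = 0\<close> is \<open>v\<^sup>* A(y) v\<close>, which forces \<open>v = 0\<close>. Since the sign of \<open>A(y)\<close> determines
  \<open>\<sigma>\<close>, at most one sign is feasible and a single semidefinite problem decides the existence of \<open>C\<close>.
\<close>

section \<open>Evaluation of polynomials\<close>

lemma poly_eval_zero [simp]: "poly_eval (\<lambda>c. c) s 0 = 0"
  by (simp add: poly_eval_def)

lemma poly_eval_add:
  "poly_eval (\<lambda>c. c) s (p + q) = poly_eval (\<lambda>c. c) s p + poly_eval (\<lambda>c. c) s q"
  unfolding poly_eval_def by (rule setsum_keys_plus_distrib) (simp_all add: distrib_right)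

lemma poly_eval_single:
  "poly_eval (\<lambda>c. c) s (Poly_Mapping.single m c) = c * (\<Prod>i\<in>UNIV. s i ^ Poly_Mapping.lookup m i)"
  by (cases "c = 0") (simp_all add: poly_eval_def)

lemma poly_eval_sum:
  "poly_eval (\<lambda>c. c) s (\<Sum>i\<in>I. p i) = (\<Sum>i\<in>I. poly_eval (\<lambda>c. c) s (p i))"
  by (induction I rule: infinite_finite_induct) (simp_all add: poly_eval_add)

lemma poly_mapping_eq_sum_single:
  "p = (\<Sum>m\<in>Poly_Mapping.keys p. Poly_Mapping.single m (Poly_Mapping.lookup p m))"
proof (rule poly_mapping_eqI)
  fix k
  show "Poly_Mapping.lookup p k = Poly_Mapping.lookup
    (\<Sum>m\<in>Poly_Mapping.keys p. Poly_Mapping.single m (Poly_Mapping.lookup p m)) k"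
    by (simp add: lookup_sum lookup_single when_def sum.delta in_keys_iff)
qed

text \<open>Both sides are bilinear, so expanding \<open>p\<close> and \<open>q\<close> into single
  terms reduces the claim to products of monomials, where exponents add.\<close>

lemma poly_eval_mult:
  fixes p q :: "('n::finite, 'a::comm_semiring_1) mpoly"
  shows "poly_eval (\<lambda>c. c) s (p * q) = poly_eval (\<lambda>c. c) s p * poly_eval (\<lambda>c. c) s q"
proof -
  let ?P = "\<lambda>m. Poly_Mapping.single m (Poly_Mapping.lookup p m)"
  let ?Q = "\<lambda>m. Poly_Mapping.single m (Poly_Mapping.lookup q m)"
  have "p * q = (\<Sum>m\<in>Poly_Mapping.keys p. ?P m) * (\<Sum>m\<in>Poly_Mapping.keys q. ?Q m)"
    by (simp flip: poly_mapping_eq_sum_single)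
  also have "poly_eval (\<lambda>c. c) s \<dots> =
      (\<Sum>m\<in>Poly_Mapping.keys p. \<Sum>k\<in>Poly_Mapping.keys q.
        poly_eval (\<lambda>c. c) s (?P m) * poly_eval (\<lambda>c. c) s (?Q k))"
    by (simp add: sum_product poly_eval_sum mult_single poly_eval_single lookup_add power_add
        prod.distrib mult_ac)
  also have "\<dots> = poly_eval (\<lambda>c. c) s (\<Sum>m\<in>Poly_Mapping.keys p. ?P m)
      * poly_eval (\<lambda>c. c) s (\<Sum>m\<in>Poly_Mapping.keys q. ?Q m)"
    by (simp add: poly_eval_sum sum_product)
  finally show ?thesis
    by (simp flip: poly_mapping_eq_sum_single)
qed

lemma poly_eval_Const [simp]: "poly_eval (\<lambda>c. c) s (Const c) = c"
  by (simp add: Const_def poly_eval_single)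

lemma poly_eval_one [simp]: "poly_eval (\<lambda>c. c) s 1 = 1"
  using poly_eval_Const[of s 1] by (simp add: Const_def)

lemma poly_eval_Var [simp]: "poly_eval (\<lambda>c. c) s (Var i) = s i"
proof -
  have "(\<Prod>k\<in>UNIV. s k ^ Poly_Mapping.lookup (Poly_Mapping.single i 1) k)
      = (\<Prod>k\<in>UNIV. if k = i then s k else 1)"
    by (rule prod.cong) (auto simp: lookup_single when_def)
  then show ?thesis
    by (simp add: Var_def poly_eval_single)
qed

lemma poly_eval_uminus:
  fixes p :: "('n::finite, 'a::comm_ring_1) mpoly"
  shows "poly_eval (\<lambda>c. c) s (- p) = - poly_eval (\<lambda>c. c) s p"
  using poly_eval_add[of s p "- p"] by (simp add: minus_unique)

lemma poly_eval_prod: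
  fixes p :: "'i \<Rightarrow> ('n::finite, 'a::comm_semiring_1) mpoly"
  shows "poly_eval (\<lambda>c. c) s (\<Prod>i\<in>I. p i) = (\<Prod>i\<in>I. poly_eval (\<lambda>c. c) s (p i))"
  by (induction I rule: infinite_finite_induct) (simp_all add: poly_eval_mult)

text \<open>Evaluation is a ring homomorphism, so it passes through the Leibniz expansion; the
  permutation signs are the constants 1 and -1.\<close>

lemma poly_eval_det:
  fixes P :: "('n::finite, 'a::comm_ring_1) mpoly^'d^'d"
  shows "poly_eval (\<lambda>c. c) s (det P) = det (\<chi> a b. poly_eval (\<lambda>c. c) s (P $ a $ b))"
proof -
  have "poly_eval (\<lambda>c. c) s (of_int (sign \<pi>) :: ('n, 'a) mpoly) = of_int (sign \<pi>)"
    for \<pi> :: "'d \<Rightarrow> 'd"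
    by (simp add: sign_def poly_eval_uminus)
  then show ?thesis
    by (simp add: det_def poly_eval_sum poly_eval_mult poly_eval_prod)
qed

lemma poly_eval_det_poly:
  "poly_eval (\<lambda>c. c) s (det_poly A0 A) =
     det (\<chi> a b. A0 $ a $ b + (\<Sum>j\<in>UNIV. A j $ a $ b * s j))"
  by (simp add: det_poly_def poly_eval_det poly_eval_add poly_eval_sum poly_eval_mult)


section \<open>Quadratic forms\<close>

lemma sum_UNIV_prod: "(\<Sum>p\<in>UNIV. g p) = (\<Sum>i\<in>UNIV. \<Sum>a\<in>UNIV. g (i, a))"
  by (simp add: sum.cartesian_product)

lemma quad_form_add: "quad_form (X + Y) v = quad_form X v + quad_form Y v"
  by (simp add: quad_form_def distrib_left distrib_right sum.distrib)

lemma quad_form_sum: "quad_form (\<Sum>k\<in>I. X k) v = (\<Sum>k\<in>I. quad_form (X k) v)"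
  by (induction I rule: infinite_finite_induct) (simp_all add: quad_form_add, simp_all add: quad_form_def)

lemma quad_form_scaleR: "quad_form (r *\<^sub>R X) v = of_real r * quad_form X v"
  by (simp add: quad_form_def sum_distrib_left mult_ac scaleR_conv_of_real[where 'a = complex])

lemma quad_form_pencil: "quad_form (pencil A x) v = (\<Sum>j\<in>UNIV. of_real (x $ j) * quad_form (A j) v)"
  by (simp add: pencil_def quad_form_sum quad_form_scaleR)

lemma quad_form_mat_vec: "quad_form X v = (\<Sum>i\<in>UNIV. cnj (v $ i) * (X *v v) $ i)"
  by (simp add: quad_form_def matrix_vector_mult_def sum_distrib_left mult_ac)

lemma quad_form_affine:
  "quad_form (\<chi> a b. A0 $ a $ b + (\<Sum>j\<in>UNIV. A j $ a $ b * z j)) v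
     = quad_form A0 v + (\<Sum>j\<in>UNIV. z j * quad_form (A j) v)"
proof -
  have "(\<chi> a b. A0 $ a $ b + (\<Sum>j\<in>UNIV. A j $ a $ b * z j))
      = A0 + (\<Sum>j\<in>UNIV. \<chi> a b. A j $ a $ b * z j)"
    by (simp add: vec_eq_iff)
  moreover have "quad_form (\<chi> a b. A j $ a $ b * z j) v = z j * quad_form (A j) v" for j
    by (simp add: quad_form_def sum_distrib_left mult_ac)
  ultimately show ?thesis
    by (simp add: quad_form_add quad_form_sum)
qed

text \<open>The value equals its own conjugate: conjugation transposes \<open>X\<close>, and
  renaming the two summation indices undoes this.\<close>

lemma hermitian_quad_form_Im:
  assumes "hermitian X"
  shows "Im (quad_form X v) = 0"
proof -
  have "cnj (quad_form X v) = (\<Sum>i\<in>UNIV. \<Sum>j\<in>UNIV. v $ i * cnj (X $ i $ j) * cnj (v $ j))"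
    by (simp add: quad_form_def)
  also have "\<dots> = (\<Sum>i\<in>UNIV. \<Sum>j\<in>UNIV. v $ i * X $ j $ i * cnj (v $ j))"
    using assms by (intro sum.cong refl) (metis complex_cnj_cnj hermitian_def)
  also have "\<dots> = quad_form X v"
    unfolding quad_form_def by (subst sum.swap) (simp add: mult_ac)
  finally show ?thesis
    by (simp add: complex_eq_iff)
qed

text \<open>The vector on the right is the Kronecker product of \<open>u\<close> and
  \<open>v\<close>. Through it, semidefiniteness of \<open>C\<close> passes to the smaller matrix
  with entries \<open>quad_form (block C i j) v\<close>.\<close>

lemma sum_quad_form_block:
  "(\<Sum>i\<in>UNIV. \<Sum>j\<in>UNIV. of_real (u i * u j) * quad_form (block C i j) v)
     = quad_form C (\<chi> p. of_real (u (fst p)) * v $ snd p)"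
proof -
  have "quad_form C (\<chi> p. of_real (u (fst p)) * v $ snd p)
      = (\<Sum>i\<in>UNIV. \<Sum>a\<in>UNIV. \<Sum>j\<in>UNIV. \<Sum>b\<in>UNIV.
          of_real (u i * u j) * (cnj (v $ a) * C $ (i, a) $ (j, b) * v $ b))"
    unfolding quad_form_def by (simp add: sum_UNIV_prod mult_ac)
  also have "\<dots> = (\<Sum>i\<in>UNIV. \<Sum>j\<in>UNIV. \<Sum>a\<in>UNIV. \<Sum>b\<in>UNIV.
          of_real (u i * u j) * (cnj (v $ a) * C $ (i, a) $ (j, b) * v $ b))"
    by (intro sum.cong refl sum.swap)
  finally show ?thesis
    by (simp add: quad_form_def block_def sum_distrib_left)
qed


section \<open>Positive semidefinite matrices\<close>

text \<open>Each step of the induction splits off the rank-one matrix of row \<open>a\<close> and leaves the Schur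
  complement, whose row \<open>a\<close> vanishes. When \<open>N a a = 0\<close>, semidefiniteness forces row \<open>a\<close> to
  vanish already, and the convention \<open>x / 0 = 0\<close> makes the same formulas apply.\<close>

lemma psd_gram:
  fixes N :: "'l::finite \<Rightarrow> 'l \<Rightarrow> real"
  assumes "finite I"
    and "\<And>i j. N i j = N j i"
    and "\<And>u. 0 \<le> (\<Sum>i\<in>UNIV. \<Sum>j\<in>UNIV. u i * u j * N i j)"
    and "\<And>i j. i \<notin> I \<Longrightarrow> N i j = 0"
  obtains w where "\<And>i j. N i j = (\<Sum>k\<in>I. w k i * w k j)"
  using assms
proof (induction I arbitrary: N thesis rule: finite_induct)
  case empty
  then show ?case
    by simp
next
  case (insert a I)
  note sym = insert.prems(2) and psd = insert.prems(3) and supp = insert.prems(4)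
  define Q where "Q u = (\<Sum>i\<in>UNIV. \<Sum>j\<in>UNIV. u i * u j * N i j)" for u
  define L where "L u = (\<Sum>j\<in>UNIV. N a j * u j)" for u
  \<comment> \<open>Moving coordinate \<open>a\<close> by \<open>t\<close> gives a quadratic
    polynomial in \<open>t\<close>. The sign of the pivot, the vanishing row and the semidefinite
    Schur complement all follow from suitable choices of \<open>t\<close>.\<close>
  have Q_shift: "Q (\<lambda>i. u i + (if i = a then t else 0)) = Q u + 2 * t * L u + t\<^sup>2 * N a a" for u t
  proof -
    have "Q (\<lambda>i. u i + (if i = a then t else 0)) =
        (\<Sum>i\<in>UNIV. \<Sum>j\<in>UNIV. u i * u j * N i j + (if i = a then t * u j * N i j else 0)
          + (if j = a then t * u i * N i j else 0)
          + (if j = a then (if i = a then t\<^sup>2 * N i j else 0) else 0))"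
      unfolding Q_def
      by (intro sum.cong refl) (auto simp: algebra_simps power2_eq_square)
    also have "\<dots> = Q u + (\<Sum>i\<in>UNIV. \<Sum>j\<in>UNIV. if i = a then t * u j * N i j else 0)
        + (\<Sum>i\<in>UNIV. t * u i * N i a) + t\<^sup>2 * N a a"
      by (simp add: sum.distrib Q_def)
    also have "(\<Sum>i\<in>UNIV. \<Sum>j\<in>UNIV. if i = a then t * u j * N i j else 0) = t * L u"
      by (subst sum.swap) (simp add: L_def sum_distrib_left mult_ac)
    also have "(\<Sum>i\<in>UNIV. t * u i * N i a) = t * L u"
      by (simp add: L_def sum_distrib_left mult_ac sym[of _ a])
    finally show ?thesis
      by simp
  qed
  have Q_nonneg: "0 \<le> Q u" for u
    using psd by (simp add: Q_def)
  have diag: "0 \<le> N a a"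
    using Q_nonneg[of "\<lambda>i. 0 + (if i = a then 1 else 0)"] unfolding Q_shift
    by (simp add: Q_def L_def)
  have row: "N a j = 0" if "N a a = 0" for j
  proof (rule ccontr)
    assume "N a j \<noteq> 0"
    define u where "u i = (if i = j then 1 else 0 :: real)" for i
    have "L u = N a j"
      by (simp add: L_def u_def if_distrib[of "(*) _"] cong: if_cong)
    \<comment> \<open>With zero pivot the polynomial in \<open>t\<close> is affine with slope
      \<open>2 * N a j\<close>; this \<open>t\<close> is where it takes the value -1.\<close>
    then have "Q (\<lambda>i. u i + (if i = a then - (Q u + 1) / (2 * N a j) else 0)) = - 1"
      using \<open>N a j \<noteq> 0\<close> that unfolding Q_shift by (simp add: field_simps)
    then show False
      using Q_nonneg by (metis neg_0_le_iff_le not_one_le_zero)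
  qed
  define N' where "N' i j = N i j - N a i * N a j / N a a" for i j
  have sym': "N' i j = N' j i" for i j
    by (simp add: N'_def sym[of i j] mult_ac)
  have psd': "0 \<le> (\<Sum>i\<in>UNIV. \<Sum>j\<in>UNIV. u i * u j * N' i j)" for u
  proof -
    have "(\<Sum>i\<in>UNIV. \<Sum>j\<in>UNIV. u i * u j * N' i j)
        = Q u - (\<Sum>i\<in>UNIV. \<Sum>j\<in>UNIV. (N a i * u i) * (N a j * u j) / N a a)"
      unfolding Q_def N'_def sum_subtractf[symmetric]
      by (intro sum.cong refl) (simp add: algebra_simps)
    also have "(\<Sum>i\<in>UNIV. \<Sum>j\<in>UNIV. (N a i * u i) * (N a j * u j) / N a a) = (L u)\<^sup>2 / N a a"
      by (simp add: L_def power2_eq_square sum_product sum_divide_distrib)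
    \<comment> \<open>For a positive pivot this shift minimizes the form along coordinate
      \<open>a\<close>, and the minimum is the form of the Schur complement. For a zero pivot the
      shift is 0 and both sides are \<open>Q u\<close>.\<close>
    also have "Q u - (L u)\<^sup>2 / N a a
        = Q (\<lambda>i. u i + (if i = a then - L u / N a a else 0))"
      unfolding Q_shift by (cases "N a a = 0") (simp_all add: field_simps power2_eq_square)
    finally show ?thesis
      using Q_nonneg by simp
  qed
  have supp': "N' i j = 0" if "i \<notin> I" for i j
  proof (cases "i = a")
    case True
    then show ?thesis
      using row by (cases "N a a = 0") (simp_all add: N'_def)
  next
    case False
    then show ?thesis
      using that supp[of i] sym[of a i] by (simp add: N'_def)
  qed
  obtain w where w: "\<And>i j. N' i j = (\<Sum>k\<in>I. w k i * w k j)"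
    using insert.IH[OF _ sym' psd' supp'] by blast
  \<comment> \<open>The new vector is row \<open>a\<close> divided by the root of the pivot, so its
    products restore the rank-one matrix that was split off. As \<open>a\<close> lies outside
    \<open>I\<close>, the other vectors are unchanged.\<close>
  define w' where "w' k i = (if k = a then N a i / sqrt (N a a) else w k i)" for k i
  have "N i j = (\<Sum>k\<in>insert a I. w' k i * w' k j)" for i j
  proof -
    have "(\<Sum>k\<in>insert a I. w' k i * w' k j) = N a i * N a j / N a a + (\<Sum>k\<in>I. w' k i * w' k j)"
      using insert.hyps diag by (simp add: w'_def)
    also have "(\<Sum>k\<in>I. w' k i * w' k j) = N' i j"
      unfolding w using insert.hyps by (intro sum.cong) (auto simp: w'_def)
    finally show ?thesis
      by (simp add: N'_def)
  qed
  then show ?case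
    by (rule insert.prems(1))
qed

text \<open>A Gram decomposition of \<open>N\<close> turns the trace into a sum of values of the
  form of \<open>D\<close> at the Gram vectors.\<close>

lemma psd_trace_nonneg:
  fixes N D :: "'l::finite \<Rightarrow> 'l \<Rightarrow> real"
  assumes "\<And>i j. N i j = N j i"
    and "\<And>u. 0 \<le> (\<Sum>i\<in>UNIV. \<Sum>j\<in>UNIV. u i * u j * N i j)"
    and "\<And>u. 0 \<le> (\<Sum>i\<in>UNIV. \<Sum>j\<in>UNIV. u i * u j * D i j)"
  shows "0 \<le> (\<Sum>i\<in>UNIV. \<Sum>j\<in>UNIV. N i j * D i j)"
proof -
  obtain w :: "'l \<Rightarrow> 'l \<Rightarrow> real" where w: "\<And>i j. N i j = (\<Sum>k\<in>UNIV. w k i * w k j)"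
    using psd_gram[of UNIV N] assms(1,2) by auto
  have "(\<Sum>i\<in>UNIV. \<Sum>j\<in>UNIV. N i j * D i j)
      = (\<Sum>i\<in>UNIV. \<Sum>k\<in>UNIV. \<Sum>j\<in>UNIV. w k i * w k j * D i j)"
    unfolding w sum_distrib_right by (intro sum.cong refl sum.swap)
  also have "\<dots> = (\<Sum>k\<in>UNIV. \<Sum>i\<in>UNIV. \<Sum>j\<in>UNIV. w k i * w k j * D i j)"
    by (rule sum.swap)
  also have "0 \<le> \<dots>"
    by (intro sum_nonneg assms(3))
  finally show ?thesis .
qed

text \<open>Semidefiniteness of the real pencil is stated over complex vectors; testing on real ones
  gives the real form used in the trace argument.\<close>

lemma pos_semidef_of_real_quadratic:
  assumes "pos_semidef (map_matrix of_real (X :: real^'l^'l))"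
  shows "0 \<le> (\<Sum>i\<in>UNIV. \<Sum>j\<in>UNIV. u i * u j * X $ i $ j)"
proof -
  have "quad_form (map_matrix of_real X) (\<chi> i. of_real (u i))
      = of_real (\<Sum>i\<in>UNIV. \<Sum>j\<in>UNIV. u i * u j * X $ i $ j)"
    by (simp add: quad_form_def mult_ac)
  moreover have "0 \<le> Re (quad_form (map_matrix of_real X) (\<chi> i. of_real (u i)))"
    using assms by (simp add: pos_semidef_def)
  ultimately show ?thesis
    by (simp only: Re_complex_of_real)
qed

lemma pos_semidef_of_real_symmetric:
  assumes "pos_semidef (map_matrix of_real (X :: real^'l^'l))"
  shows "X $ i $ j = X $ j $ i"
  using assms by (simp add: pos_semidef_def hermitian_def)


section \<open>Certificates\<close>

lemma certificate_nonneg: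
  fixes A :: "'n::finite \<Rightarrow> complex^'d^'d" and M :: "'n \<Rightarrow> real^'l^'l"
  assumes "certificate A M \<sigma> C" and "pos_semidef (map_matrix of_real (pencil M x))"
  shows "0 \<le> \<sigma> * Re (quad_form (pencil A x) v)"
proof -
  let ?q = "\<lambda>i j. quad_form (block C i j) v"
  have "of_real \<sigma> * quad_form (A p) v = (\<Sum>i\<in>UNIV. \<Sum>j\<in>UNIV. of_real (M p $ i $ j) * ?q i j)" for p
  proof -
    have "of_real \<sigma> * quad_form (A p) v = quad_form (\<sigma> *\<^sub>R A p) v"
      by (simp add: quad_form_scaleR)
    also have "\<sigma> *\<^sub>R A p = (\<Sum>i\<in>UNIV. \<Sum>j\<in>UNIV. M p $ i $ j *\<^sub>R block C i j)"
      using assms(1) by (simp add: certificate_def)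
    finally show ?thesis
      by (simp add: quad_form_sum quad_form_scaleR)
  qed
  then have "of_real \<sigma> * quad_form (pencil A x) v
      = (\<Sum>p\<in>UNIV. \<Sum>i\<in>UNIV. \<Sum>j\<in>UNIV. of_real (x $ p * M p $ i $ j) * ?q i j)"
    by (simp add: quad_form_pencil sum_distrib_left mult.left_commute[of "of_real \<sigma>"] mult.assoc)
  also have "\<dots> = (\<Sum>i\<in>UNIV. \<Sum>p\<in>UNIV. \<Sum>j\<in>UNIV. of_real (x $ p * M p $ i $ j) * ?q i j)"
    by (rule sum.swap)
  also have "\<dots> = (\<Sum>i\<in>UNIV. \<Sum>j\<in>UNIV. \<Sum>p\<in>UNIV. of_real (x $ p * M p $ i $ j) * ?q i j)"
    by (intro sum.cong refl sum.swap)
  also have "\<dots> = (\<Sum>i\<in>UNIV. \<Sum>j\<in>UNIV. of_real (pencil M x $ i $ j) * ?q i j)"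
    by (simp add: pencil_def sum_distrib_right)
  \<comment> \<open>The entries of \<open>pencil M x\<close> are real, so the real part may be taken
    in each block term separately. This leaves a trace of two real matrices.\<close>
  finally have "Re (of_real \<sigma> * quad_form (pencil A x) v)
      = (\<Sum>i\<in>UNIV. \<Sum>j\<in>UNIV. pencil M x $ i $ j * Re (?q i j))"
    by simp
  moreover have "0 \<le> (\<Sum>i\<in>UNIV. \<Sum>j\<in>UNIV. pencil M x $ i $ j * Re (?q i j))"
  proof (rule psd_trace_nonneg)
    fix u :: "'l \<Rightarrow> real"
    have "(\<Sum>i\<in>UNIV. \<Sum>j\<in>UNIV. u i * u j * Re (?q i j))
        = Re (\<Sum>i\<in>UNIV. \<Sum>j\<in>UNIV. of_real (u i * u j) * ?q i j)"
      by simp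
    also have "\<dots> \<ge> 0"
      using assms(1) unfolding sum_quad_form_block by (simp add: certificate_def pos_semidef_def)
    finally show "0 \<le> (\<Sum>i\<in>UNIV. \<Sum>j\<in>UNIV. u i * u j * Re (?q i j))" .
  qed (use assms(2) in \<open>auto intro: pos_semidef_of_real_quadratic pos_semidef_of_real_symmetric\<close>)
  ultimately show ?thesis
    by simp
qed

text \<open>Along the line through \<open>x\<close> in direction \<open>e\<close> the functional is
  affine with nonzero slope. It is nonnegative at two points symmetric about \<open>x\<close>, hence
  positive at \<open>x\<close>.\<close>

lemma certificate_interior_pos:
  fixes A :: "'n::finite \<Rightarrow> complex^'d^'d" and M :: "'n \<Rightarrow> real^'l^'l"
  assumes cert: "certificate A M \<sigma> C" and "\<sigma> \<noteq> 0" and e: "pos_def (pencil A e)"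
    and x: "x \<in> interior {x. pos_semidef (map_matrix of_real (pencil M x))}" (is "_ \<in> interior ?K")
    and "v \<noteq> 0"
  shows "0 < \<sigma> * Re (quad_form (pencil A x) v)"
proof -
  define g where "g y = \<sigma> * Re (quad_form (pencil A y) v)" for y
  have g_line: "g (x + t *\<^sub>R e) = g x + t * g e" for t
    by (simp add: g_def quad_form_pencil algebra_simps sum.distrib sum_distrib_left)
  have g_nonneg: "0 \<le> g y" if "y \<in> ?K" for y
    using certificate_nonneg[OF cert] that by (simp add: g_def)
  have "g e \<noteq> 0"
    using e \<open>\<sigma> \<noteq> 0\<close> \<open>v \<noteq> 0\<close> by (auto simp: g_def pos_def_def)
  obtain r where "r > 0" and r: "ball x r \<subseteq> ?K"
    using x by (meson mem_interior)
  \<comment> \<open>Any positive \<open>t\<close> with \<open>t * norm e < r\<close> keeps both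
    points in the ball; the \<open>+ 1\<close> makes the denominator positive without a case split
    on \<open>e\<close>.\<close>
  define t where "t = r / (2 * (norm e + 1))"
  have "t > 0"
    using \<open>r > 0\<close> by (simp add: t_def add_nonneg_pos)
  have "t * norm e < t * (2 * (norm e + 1))"
    using \<open>t > 0\<close> by (simp add: add_nonneg_pos)
  also have "\<dots> = r"
    by (simp add: t_def add_nonneg_eq_0_iff)
  finally have "x + s *\<^sub>R e \<in> ?K" if "\<bar>s\<bar> = t" for s
    using that by (intro subsetD[OF r]) (simp add: dist_norm)
  then have "0 \<le> g (x + t *\<^sub>R e)" "0 \<le> g (x + (- t) *\<^sub>R e)"
    using \<open>t > 0\<close> by (simp_all only: g_nonneg abs_minus_cancel abs_of_pos)
  then have "0 \<le> g x + t * g e" "0 \<le> g x - t * g e"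
    unfolding g_line by simp_all
  moreover have "t * g e \<noteq> 0"
    using \<open>t > 0\<close> \<open>g e \<noteq> 0\<close> by simp
  ultimately have "0 < g x"
    by linarith
  then show ?thesis
    by (simp add: g_def)
qed

text \<open>The form is only asked to be nonzero, not positive, so that both signs of \<sigma> are
  covered: a kernel vector of the evaluated matrix would make it vanish.\<close>

lemma det_poly_nonzero_of_definite:
  assumes "hermitian A0" and "\<And>j. hermitian (A j)"
    and "\<And>v. v \<noteq> 0 \<Longrightarrow> Re (quad_form (pencil A (\<chi> j. Im (z $ j))) v) \<noteq> 0"
  shows "poly_eval (\<lambda>c. c) (($) z) (det_poly A0 A) \<noteq> 0"
proof -
  let ?N = "\<chi> a b. A0 $ a $ b + (\<Sum>j\<in>UNIV. A j $ a $ b * z $ j)"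
  have "v = 0" if "?N *v v = 0" for v
  proof (rule ccontr)
    assume "v \<noteq> 0"
    have "quad_form ?N v = 0"
      unfolding quad_form_mat_vec that by simp
    then have "0 = Im (quad_form A0 v + (\<Sum>j\<in>UNIV. z $ j * quad_form (A j) v))"
      by (simp flip: quad_form_affine)
    also have "\<dots> = Re (quad_form (pencil A (\<chi> j. Im (z $ j))) v)"
      using assms(1,2) by (simp add: hermitian_quad_form_Im quad_form_pencil)
    finally show False
      using assms(3) \<open>v \<noteq> 0\<close> by simp
  qed
  then have "invertible ?N"
    by (simp add: invertible_left_inverse matrix_left_invertible_ker)
  then show ?thesis
    by (simp add: poly_eval_det_poly invertible_det_nz)
qed

section \<open>Certificates as a semidefinite feasibility problem\<close>

lemma finite_certificate_system: "finite (certificate_system A M \<sigma>)"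
  by (simp add: certificate_system_def)

lemma sdp_feasible_set_certificate_system:
  fixes A :: "'n::finite \<Rightarrow> complex^'d^'d" and M :: "'n \<Rightarrow> real^'l^'l"
  shows "sdp_feasible_set (certificate_system A M \<sigma>) = {C. certificate A M \<sigma> C}"
proof -
  have entry: "(\<Sum>r\<in>UNIV. \<Sum>c\<in>UNIV.
        (if snd r = a \<and> snd c = b then of_real (M p $ fst r $ fst c) else 0) * C $ r $ c)
      = (\<Sum>i\<in>UNIV. \<Sum>j\<in>UNIV. M p $ i $ j *\<^sub>R block C i j) $ a $ b"
    for C :: "complex^('l \<times> 'd)^('l \<times> 'd)" and p a b
  proof -
    \<comment> \<open>Splitting the pair indices and nesting the conditions lets the sum over
      \<open>b'\<close> collapse first and, after a swap, the sum over \<open>a'\<close>.\<close>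
    have "(\<Sum>r\<in>UNIV. \<Sum>c\<in>UNIV.
          (if snd r = a \<and> snd c = b then of_real (M p $ fst r $ fst c) else 0) * C $ r $ c)
        = (\<Sum>i\<in>UNIV. \<Sum>a'\<in>UNIV. \<Sum>j\<in>UNIV. \<Sum>b'\<in>UNIV.
          if b' = b then (if a' = a then of_real (M p $ i $ j) * C $ (i, a') $ (j, b') else 0) else 0)"
      unfolding sum_UNIV_prod by (intro sum.cong refl) simp
    also have "\<dots> = (\<Sum>i\<in>UNIV. \<Sum>j\<in>UNIV. \<Sum>a'\<in>UNIV.
          if a' = a then of_real (M p $ i $ j) * C $ (i, a') $ (j, b) else 0)"
      by (simp, intro sum.cong refl, subst sum.swap, simp)
    finally show ?thesis
      by (simp add: block_def) (simp add: scaleR_conv_of_real)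
  qed
  show ?thesis
    by (auto simp: sdp_feasible_set_def certificate_system_def certificate_def entry vec_eq_iff
        scaleR_conv_of_real[where 'a = complex])
qed

text \<open>Full dimension makes the affine hull the whole space, so the interior is the relative
  interior, which is nonempty for a nonempty convex set.\<close>

lemma proper_cone_interior_nonempty:
  assumes "proper_cone (K :: (real^'n) set)"
  shows "interior K \<noteq> {}"
proof -
  have "K \<noteq> {}" "convex K" "affine hull K = UNIV"
    using assms by (auto simp: proper_cone_def convex_cone_def simp flip: aff_dim_eq_full)
  then show ?thesis
    using rel_interior_interior rel_interior_eq_empty by metis
qed

theorem theorem4p3:
  fixes A0 :: "complex^'d^'d"
    and A :: "'n::finite \<Rightarrow> complex^'d^'d"
    and M :: "'n \<Rightarrow> real^'l^'l"
    and K :: "(real^'n) set"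
    and f :: "('n, complex) mpoly"
  assumes "hermitian A0" and "\<And>j. hermitian (A j)"
    and "f = det_poly A0 A"
    and "total_degree f = CARD('d)"
    and "irreducible (initial_form f)"
    and "\<exists>e. pos_def (pencil A e)"
    and "proper_cone K"
    and "\<And>j. transpose (M j) = M j"
    and "K = {x. pos_semidef (map_matrix of_real (pencil M x))}"
  shows "((\<exists>\<sigma>\<in>{-1, 1}. \<exists>C. certificate A M \<sigma> C) \<longrightarrow> K_stable K f)
    \<and> (\<forall>\<sigma>\<in>{-1, 1}. finite (certificate_system A M \<sigma>)
          \<and> {C. certificate A M \<sigma> C} = sdp_feasible_set (certificate_system A M \<sigma>))
    \<and> (\<exists>\<sigma>\<in>{-1, 1}. {C. \<exists>\<tau>\<in>{-1, 1}. certificate A M \<tau> C}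
          = sdp_feasible_set (certificate_system A M \<sigma>))"
proof (intro conjI)
  obtain e where e: "pos_def (pencil A e)"
    using assms(6) by blast
  have pos: "0 < \<sigma> * Re (quad_form (pencil A x) v)"
    if "certificate A M \<sigma> C" "\<sigma> \<in> {-1, 1}" "x \<in> interior K" "v \<noteq> 0" for \<sigma> C x v
    using certificate_interior_pos[OF that(1) _ e] that assms(9) by auto
  show "(\<exists>\<sigma>\<in>{-1, 1}. \<exists>C. certificate A M \<sigma> C) \<longrightarrow> K_stable K f"
  proof (intro impI)
    assume "\<exists>\<sigma>\<in>{-1, 1}. \<exists>C. certificate A M \<sigma> C"
    then obtain \<sigma> C where C: "\<sigma> \<in> {-1, 1}" "certificate A M \<sigma> C"
      by blast
    show "K_stable K f"
      unfolding K_stable_def assms(3)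
    proof (intro allI impI det_poly_nonzero_of_definite[OF assms(1,2)])
      fix z :: "complex^'n" and v :: "complex^'d"
      assume "(\<chi> j. Im (z $ j)) \<in> interior K" and "v \<noteq> 0"
      from pos[OF C(2,1) this] show "Re (quad_form (pencil A (\<chi> j. Im (z $ j))) v) \<noteq> 0"
        by auto
    qed
  qed
  show "\<forall>\<sigma>\<in>{-1, 1}. finite (certificate_system A M \<sigma>)
      \<and> {C. certificate A M \<sigma> C} = sdp_feasible_set (certificate_system A M \<sigma>)"
    by (simp add: finite_certificate_system sdp_feasible_set_certificate_system)
  obtain x where x: "x \<in> interior K"
    using proper_cone_interior_nonempty[OF assms(7)] by blast
  \<comment> \<open>At an interior point, certificates of both signs would make one real number both
    positive and negative. The all-ones vector \<open>1\<close> serves as a nonzero test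
    vector.\<close>
  have "\<not> (certificate A M (-1) C \<and> certificate A M 1 C')" for C C'
    using pos[of "-1" C x 1] pos[of 1 C' x 1] x by fastforce
  \<comment> \<open>The set for one of the signs is empty, so the union over both signs is the
    feasible set of the other.\<close>
  then show "\<exists>\<sigma>\<in>{-1, 1}. {C. \<exists>\<tau>\<in>{-1, 1}. certificate A M \<tau> C}
      = sdp_feasible_set (certificate_system A M \<sigma>)"
    unfolding sdp_feasible_set_certificate_system by blast
qed

end
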